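(* The Santaló map $s:(\mathcal{K}^n,d_H)\to\mathbb{R}^n$, $K\mapsto s(K)$, is continuous. Furthermore, for every convex body $K_0$ in $\mathbb{R}^n$ there exist positive constants $C=C(K_0)$ and $\delta=\delta(K_0)$ such that for every convex body $K$ in $\mathbb{R}^n$, $$d_H(K,K_0)\le\delta\quad\Longrightarrow\quad |s(K)-s(K_0)|\le C\,d_H(K,K_0).$$
   Context: A convex body in $\mathbb{R}^n$ is a compact convex set with nonempty interior; $\mathcal{K}^n$ is the space of convex bodies in $\mathbb{R}^n$ and $d_H$ is the Hausdorff metric on it. For a convex body $K$ and $z\in\mathrm{int}(K)$, the polar body of $K$ with center $z$ is $K^z=\{y\in\mathbb{R}^n:\langle y,x-z\rangle\le 1\text{ for all }x\in K\}$. The Santaló point $s(K)$ of $K$ is the unique point of $\mathrm{int}(K)$ with $|K^{s(K)}|=\min_{z\in\mathrm{int}(K)}|K^z|$, where $|\cdot|$ of a set is its volume (existence and uniqueness is a well known result of Santaló). For a vector $x$, $|x|$ is its Euclidean norm. *)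

theory Defs
  imports "HOL-Analysis.Analysis"
begin

definition convex_body :: "'a::euclidean_space set \<Rightarrow> bool" where
  "convex_body K \<longleftrightarrow> compact K \<and> convex K \<and> interior K \<noteq> {}"

definition convex_bodies :: "'a::euclidean_space set set" where
  "convex_bodies = {K. convex_body K}"

text \<open>The value 0 on empty or unbounded arguments is a convention only: real suprema are
  unspecified there, and \<^locale>\<open>Metric_space\<close> asks for nonnegativity and symmetry on the whole type.\<close>

definition hausdorff_dist :: "'a::metric_space set \<Rightarrow> 'a set \<Rightarrow> real" where
  "hausdorff_dist A B =
     (if A = {} \<or> B = {} \<or> \<not> bounded A \<or> \<not> bounded B then 0
      else max (SUP x\<in>A. infdist x B) (SUP y\<in>B. infdist y A))"

definition polar_body :: "'a::euclidean_space set \<Rightarrow> 'a \<Rightarrow> 'a set" where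
  "polar_body K z = {y. \<forall>x\<in>K. y \<bullet> (x - z) \<le> 1}"

definition santalo_point :: "'a::euclidean_space set \<Rightarrow> 'a" where
  "santalo_point K =
     (THE z. z \<in> interior K \<and>
        (\<forall>w\<in>interior K. measure lebesgue (polar_body K z) \<le> measure lebesgue (polar_body K w)))"

lemma bdd_above_infdist:
  fixes A B :: "'a::metric_space set"
  assumes "bounded A" "B \<noteq> {}"
  shows "bdd_above ((\<lambda>x. infdist x B) ` A)"
proof -
  obtain b where b: "b \<in> B" using assms by blast
  obtain e where e: "\<forall>x\<in>A. dist b x \<le> e"
    using assms(1) bounded_any_center[of A b] by blast
  have "infdist x B \<le> e" if "x \<in> A" for x
    using infdist_le[OF b, of x] e that by (metis dist_commute order_trans)
  then show ?thesis by (intro bdd_aboveI2)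
qed

lemma infdist_le_hausdorff_dist:
  fixes A B :: "'a::metric_space set"
  assumes "bounded A" "bounded B" "x \<in> A" "B \<noteq> {}"
  shows "infdist x B \<le> hausdorff_dist A B"
proof -
  have "infdist x B \<le> (SUP x\<in>A. infdist x B)"
    using assms by (intro cSUP_upper bdd_above_infdist)
  then show ?thesis using assms by (auto simp: hausdorff_dist_def)
qed

lemma hausdorff_dist_commute: "hausdorff_dist A B = hausdorff_dist B A"
  by (auto simp: hausdorff_dist_def max.commute)

lemma hausdorff_dist_nonneg: "0 \<le> hausdorff_dist A B"
proof (cases "A = {} \<or> B = {} \<or> \<not> bounded A \<or> \<not> bounded B")
  case False
  then obtain x where "x \<in> A" by blast
  then show ?thesis
    using False infdist_le_hausdorff_dist[of A B x] infdist_nonneg[of x B] by force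
qed (auto simp: hausdorff_dist_def)

lemma hausdorff_dist_leI:
  fixes A B :: "'a::metric_space set"
  assumes "A \<noteq> {}" "B \<noteq> {}"
    and "\<And>x. x \<in> A \<Longrightarrow> infdist x B \<le> c" "\<And>y. y \<in> B \<Longrightarrow> infdist y A \<le> c" "0 \<le> c"
  shows "hausdorff_dist A B \<le> c"
  using assms by (auto simp: hausdorff_dist_def intro!: cSUP_least)

lemma infdist_hausdorff_triangle:
  fixes A B C :: "'a::metric_space set"
  assumes "bounded A" "bounded B" "bounded C" "B \<noteq> {}" "C \<noteq> {}" "x \<in> A"
  shows "infdist x C \<le> hausdorff_dist A B + hausdorff_dist B C"
proof -
  have "infdist x C - hausdorff_dist B C \<le> dist x y" if "y \<in> B" for y
    using infdist_triangle[of x C y] infdist_le_hausdorff_dist[of B C y] assms that by auto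
  then have "infdist x C - hausdorff_dist B C \<le> infdist x B"
    using assms by (auto simp: infdist_notempty intro!: cINF_greatest)
  then show ?thesis using infdist_le_hausdorff_dist[of A B x] assms by force
qed

interpretation convex_bodies: Metric_space convex_bodies hausdorff_dist
proof
  fix A B C :: "'a set"
  show "0 \<le> hausdorff_dist A B" by (rule hausdorff_dist_nonneg)
  show "hausdorff_dist A B = hausdorff_dist B A" by (rule hausdorff_dist_commute)
  have body: "bounded S" "closed S" "S \<noteq> {}" if "S \<in> convex_bodies" for S :: "'a set"
    using that by (auto simp: convex_bodies_def convex_body_def compact_imp_bounded compact_imp_closed)
  { assume AB: "A \<in> convex_bodies" "B \<in> convex_bodies"
    have sub: "S \<subseteq> T" if "hausdorff_dist S T = 0" "S \<in> convex_bodies" "T \<in> convex_bodies"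
      for S T :: "'a set"
    proof
      fix x assume "x \<in> S"
      then have "infdist x T = 0"
        using infdist_le_hausdorff_dist[of S T x] infdist_nonneg[of x T] that body by force
      then show "x \<in> T" using body[OF that(3)] in_closed_iff_infdist_zero by blast
    qed
    have "hausdorff_dist A A \<le> 0"
      using body[OF AB(1)] by (intro hausdorff_dist_leI) auto
    then have "hausdorff_dist A A = 0" using hausdorff_dist_nonneg[of A A] by simp
    then show "hausdorff_dist A B = 0 \<longleftrightarrow> A = B"
      using sub[of A B] sub[of B A] AB hausdorff_dist_commute[of A B] by auto }
  { assume "A \<in> convex_bodies" "B \<in> convex_bodies" "C \<in> convex_bodies"
    then show "hausdorff_dist A C \<le> hausdorff_dist A B + hausdorff_dist B C"
      using body[of A] body[of B] body[of C]
        infdist_hausdorff_triangle[of A B C] infdist_hausdorff_triangle[of C B A]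
      by (intro hausdorff_dist_leI)
        (auto simp: hausdorff_dist_commute hausdorff_dist_nonneg add.commute) }
qed

end

theory Submission
  imports Defs "HOL-Probability.Distributions"
begin

text \<open>
  Let $h_K$ be the support function of \<open>K\<close>, let $n$ be the dimension, and let
  $F_K(z) = \int \exp(\langle z,y\rangle - h_K(y))\,dy$. For $z$ in the interior of \<open>K\<close> the
  function $h_K - \langle z,\cdot\rangle$ is the gauge of the polar body with centre $z$, and the
  layer-cake formula gives $F_K(z) = n!\,|K^z|$ (\<open>polar_potential_eq_volume\<close>). So the Santalo
  point is the minimiser of $F_K$, and it suffices to study this minimiser.

  Existence: $F_K$ is lower semicontinuous by Fatou's lemma and infinite on the boundary of \<open>K\<close>
  (\<open>ex_minimiser_polar_potential\<close>). Uniqueness and stability both come from a quantitative form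
  of strict convexity. The midpoint identity
  $\frac12(e^{a} + e^{b}) - e^{(a+b)/2} = \frac12(e^{a/2} - e^{b/2})^2$, integrated, yields
  $F_K(w) - F_K(s) \ge \kappa\,|w-s|^2$ at a minimiser $s$ (\<open>polar_potential_growth\<close>).

  Let $s_0$ be the Santalo point of $K_0$, put $d = d_H(K,K_0)$, and let $w$ be near $s_0$ with
  $F_K(w) \le F_K(s_0)$. Then
  \[ \kappa\,|w-s_0|^2 \le F_{K_0}(w) - F_{K_0}(s_0)
     \le (F_{K_0} - F_K)(w) - (F_{K_0} - F_K)(s_0) \le M\, d\, |w-s_0| , \]
  since $|h_K(y) - h_{K_0}(y)| \le d\,|y|$ (\<open>polar_potential_diff_lipschitz\<close>). Hence
  $|w-s_0| \le (M/\kappa)\, d$. No derivatives of $F_K$ enter. Convexity of $F_K$ allows \<open>w\<close> to be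
  chosen on the segment from $s_0$ to the Santalo point of \<open>K\<close>, and the estimate then forces \<open>w\<close>
  to be that point (\<open>santalo_point_locally_lipschitz\<close>). Continuity of the Santalo map is the
  local Lipschitz bound at each body.
\<close>

section \<open>Support functions\<close>

definition support_fun :: "'a::euclidean_space set \<Rightarrow> 'a \<Rightarrow> real" where
  "support_fun K y = (SUP x\<in>K. x \<bullet> y)"

lemma bdd_above_inner_image:
  fixes K :: "'a::euclidean_space set"
  assumes "bounded K"
  shows "bdd_above ((\<lambda>x. x \<bullet> y) ` K)"
proof -
  obtain R where R: "\<forall>x\<in>K. norm x \<le> R" using assms bounded_iff by blast
  have "x \<bullet> y \<le> R * norm y" if "x \<in> K" for x
    using norm_cauchy_schwarz[of x y] mult_right_mono[of "norm x" R "norm y"] R that by force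
  then show ?thesis by (intro bdd_aboveI2)
qed

lemma inner_le_support_fun: "bounded K \<Longrightarrow> x \<in> K \<Longrightarrow> x \<bullet> y \<le> support_fun K y"
  unfolding support_fun_def by (intro cSUP_upper bdd_above_inner_image)

lemma support_fun_le_iff:
  assumes "bounded K" "K \<noteq> {}"
  shows "support_fun K y \<le> c \<longleftrightarrow> (\<forall>x\<in>K. x \<bullet> y \<le> c)"
  unfolding support_fun_def using assms by (intro cSUP_le_iff bdd_above_inner_image)

text \<open>Positive homogeneity and subadditivity of the support function are what make
  $h_K - \langle z,\cdot\rangle$ a gauge, namely that of the polar body with centre $z$.\<close>
lemma support_fun_scaleR:
  assumes "bounded K" "K \<noteq> {}" "0 \<le> t"
  shows "support_fun K (t *\<^sub>R y) = t * support_fun K y"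
proof (cases "t = 0")
  case True
  then show ?thesis using assms by (simp add: support_fun_def)
next
  case False
  then have "t > 0" using assms by simp
  then have "support_fun K (t *\<^sub>R y) \<le> c \<longleftrightarrow> t * support_fun K y \<le> c" for c
    using assms support_fun_le_iff[OF assms(1,2), of y "c / t"]
      support_fun_le_iff[OF assms(1,2), of "t *\<^sub>R y" c]
    by (simp add: pos_le_divide_eq mult.commute)
  then show ?thesis by (metis order_antisym order_refl)
qed

lemma support_fun_add_le:
  assumes "bounded K" "K \<noteq> {}"
  shows "support_fun K (x + y) \<le> support_fun K x + support_fun K y"
  unfolding support_fun_le_iff[OF assms]
  using inner_le_support_fun[OF assms(1)] by (auto simp: inner_add_right intro: add_mono)

lemma support_fun_le_norm:
  assumes "K \<noteq> {}" "K \<subseteq> cball 0 R"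
  shows "support_fun K y \<le> R * norm y"
proof -
  have "bounded K" using assms bounded_subset by blast
  moreover have "x \<bullet> y \<le> R * norm y" if "x \<in> K" for x
    using norm_cauchy_schwarz[of x y] mult_right_mono[of "norm x" R "norm y"] assms that by force
  ultimately show ?thesis using support_fun_le_iff assms by blast
qed

text \<open>The bound is attained by testing with the point of the ball that lies farthest in the
  direction of \<open>y\<close>.\<close>
lemma support_fun_ge_cball:
  assumes "bounded K" "cball z r \<subseteq> K" "0 \<le> r"
  shows "z \<bullet> y + r * norm y \<le> support_fun K y"
proof -
  have "(z + r *\<^sub>R sgn y) \<bullet> y \<le> support_fun K y"
    using assms by (intro inner_le_support_fun) (auto simp: dist_norm norm_sgn subset_iff)
  moreover have "sgn y \<bullet> y = norm y"
    by (cases "y = 0") (simp_all add: sgn_div_norm dot_square_norm power2_eq_square)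
  ultimately show ?thesis by (simp add: inner_add_left)
qed

text \<open>Subadditivity turns the bound $h_K(y) \le R |y|$ into a Lipschitz bound.\<close>
lemma continuous_on_support_fun:
  assumes "bounded K" "K \<noteq> {}"
  shows "continuous_on UNIV (support_fun K)"
proof -
  obtain R where R: "K \<subseteq> cball 0 R" "R > 0"
    using assms(1) bounded_pos[of K] by (metis mem_cball_0 subsetI)
  have *: "support_fun K x - support_fun K y \<le> R * dist x y" for x y
    using support_fun_add_le[OF assms, of "x - y" y] support_fun_le_norm[OF assms(2) R(1), of "x - y"]
    by (simp add: dist_norm)
  have "R-lipschitz_on UNIV (support_fun K)"
  proof (rule lipschitz_onI)
    show "dist (support_fun K x) (support_fun K y) \<le> R * dist x y" for x y
      using *[of x y] *[of y x] by (simp add: dist_real_def dist_commute[of y x] abs_le_iff)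
  qed (use R in simp)
  then show ?thesis by (rule lipschitz_on_continuous_on)
qed

text \<open>This is the only way in which the Hausdorff distance enters the argument: it bounds the
  difference of the support functions, uniformly on the unit sphere.\<close>
lemma support_fun_le_hausdorff_dist:
  assumes "compact K" "K \<noteq> {}" "compact L" "L \<noteq> {}"
  shows "support_fun K y \<le> support_fun L y + hausdorff_dist K L * norm y"
proof -
  have bd: "bounded K" "bounded L" using assms by (auto simp: compact_imp_bounded)
  have "x \<bullet> y \<le> support_fun L y + hausdorff_dist K L * norm y" if x: "x \<in> K" for x
  proof -
    obtain x' where x': "x' \<in> L" "infdist x L = dist x x'"
      using infdist_attains_inf[of L x] assms compact_imp_closed by blast
    have "norm (x - x') \<le> hausdorff_dist K L"
      using infdist_le_hausdorff_dist[OF bd x assms(4)] x' by (simp add: dist_norm)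
    then have "(x - x') \<bullet> y \<le> hausdorff_dist K L * norm y"
      by (meson norm_cauchy_schwarz mult_right_mono norm_ge_zero order_trans)
    then show ?thesis using inner_le_support_fun[OF bd(2) x'(1), of y] by (simp add: inner_diff_left)
  qed
  then show ?thesis using support_fun_le_iff[OF bd(1) assms(2)] by blast
qed

section \<open>Polar bodies and the volume of the unit ball of a gauge\<close>

lemma polar_body_eq:
  assumes "bounded K" "K \<noteq> {}"
  shows "polar_body K z = {y. support_fun K y - z \<bullet> y \<le> 1}"
proof -
  have "support_fun K y - z \<bullet> y \<le> 1 \<longleftrightarrow> (\<forall>x\<in>K. y \<bullet> (x - z) \<le> 1)" for y
    using support_fun_le_iff[OF assms, of y "1 + z \<bullet> y"]
    by (simp add: algebra_simps inner_commute)
  then show ?thesis by (auto simp: polar_body_def)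
qed

text \<open>Layer-cake formula: writing $e^{-g(y)}$ as $\int_{g(y)}^\infty e^{-t}\,dt$ and exchanging the
  integrals leaves the volumes of the sublevel sets of \<open>g\<close>, which by homogeneity are dilates
  of the unit sublevel set; the factor is $\int_0^\infty t^n e^{-t}\,dt = n!$.\<close>
lemma nn_integral_exp_neg_gauge:
  fixes g :: "'a::euclidean_space \<Rightarrow> real"
  assumes g[measurable]: "g \<in> borel_measurable borel"
    and pos: "\<And>y. y \<noteq> 0 \<Longrightarrow> 0 < g y"
    and hom: "\<And>t y. 0 \<le> t \<Longrightarrow> g (t *\<^sub>R y) = t * g y"
  shows "(\<integral>\<^sup>+y. ennreal (exp (- g y)) \<partial>lborel) = ennreal (fact DIM('a)) * emeasure lborel {y. g y \<le> 1}"
proof -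
  have g0: "g 0 = 0" using hom[of 0 0] by simp
  have nonneg: "0 \<le> g y" for y using pos[of y] g0 by (cases "y = 0") auto
  have meas: "{y. g y \<le> t} \<in> sets borel" for t by measurable
  \<comment> \<open>This includes t = 0, where both sides are {0} because g is definite.\<close>
  have slice: "{y. g y \<le> t} = (*\<^sub>R) t ` {y. g y \<le> 1}" if "0 \<le> t" for t
  proof (cases "t = 0")
    case True
    then have "{y. g y \<le> t} = {0}" using pos g0 by force
    moreover have "(\<lambda>y. 0::'a) ` {y. g y \<le> 1} = {0}" using g0 by (intro image_constant[of 0]) simp
    moreover have "(*\<^sub>R) 0 = (\<lambda>y::'a. 0)" by (simp add: fun_eq_iff)
    ultimately show ?thesis using True by simp
  next
    case False
    then have t: "t > 0" using that by simp
    have "y \<in> (*\<^sub>R) t ` {y. g y \<le> 1}" if "g y \<le> t" for y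
    proof (rule image_eqI)
      show "y = t *\<^sub>R (inverse t *\<^sub>R y)" using t by simp
      have "g (inverse t *\<^sub>R y) = g y / t"
        using t hom[of "inverse t" y] by (simp add: divide_inverse mult.commute)
      then show "inverse t *\<^sub>R y \<in> {y. g y \<le> 1}" using t that by simp
    qed
    moreover have "t *\<^sub>R y \<in> {y. g y \<le> t}" if "g y \<le> 1" for y
      using hom[of t y] t mult_left_mono[OF that, of t] by simp
    ultimately show ?thesis by blast
  qed
  have vol: "emeasure lborel {y. g y \<le> t} = ennreal (t ^ DIM('a)) * emeasure lborel {y. g y \<le> 1}"
    if "0 \<le> t" for t
  proof -
    have "emeasure lebesgue {y. g y \<le> t} = ennreal (t ^ DIM('a)) * emeasure lebesgue {y. g y \<le> 1}"
      using emeasure_lebesgue_affine[of t 0 "{y. g y \<le> 1}"] that by (simp flip: slice[OF that])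
    then show ?thesis using meas[of t] meas[of 1] by simp
  qed
  have "(\<integral>\<^sup>+y. ennreal (exp (- g y)) \<partial>lborel)
      = (\<integral>\<^sup>+y. (\<integral>\<^sup>+t. ennreal (exp (-t)) * indicator {g y..} t \<partial>lborel) \<partial>lborel)"
  proof (intro nn_integral_cong)
    fix y :: 'a
    have "((\<lambda>t::real. - exp (- t)) \<longlongrightarrow> 0) at_top"
      using tendsto_minus[OF filterlim_compose[OF exp_at_bot filterlim_uminus_at_bot_at_top]] by simp
    then have "(\<integral>\<^sup>+t. ennreal (exp (-t)) * indicator {g y..} t \<partial>lborel) = 0 - (- exp (- g y))"
      by (intro nn_integral_FTC_atLeast) (auto intro!: derivative_eq_intros)
    then show "ennreal (exp (- g y)) = (\<integral>\<^sup>+t. ennreal (exp (-t)) * indicator {g y..} t \<partial>lborel)" by simp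
  qed
  also have "\<dots> = (\<integral>\<^sup>+y. (\<integral>\<^sup>+t. ennreal (exp (-t)) * (if g y \<le> t then 1 else 0) \<partial>lborel) \<partial>lborel)"
    by (intro nn_integral_cong) (auto simp: indicator_def)
  also have "\<dots> = (\<integral>\<^sup>+t. (\<integral>\<^sup>+y. ennreal (exp (-t)) * (if g y \<le> t then 1 else 0) \<partial>lborel) \<partial>lborel)"
    by (rule lborel_pair.Fubini') measurable
  also have "\<dots> = (\<integral>\<^sup>+t. ennreal (t ^ DIM('a) * exp (-t)) * indicator {0..} t
                        * emeasure lborel {y. g y \<le> 1} \<partial>lborel)"
  proof (intro nn_integral_cong)
    fix t :: real
    have "(\<integral>\<^sup>+y. ennreal (exp (-t)) * (if g y \<le> t then 1 else 0) \<partial>lborel)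
        = (\<integral>\<^sup>+y. ennreal (exp (-t)) * indicator {y. g y \<le> t} y \<partial>lborel)"
      by (intro nn_integral_cong) (auto simp: indicator_def)
    also have "\<dots> = ennreal (exp (-t)) * emeasure lborel {y. g y \<le> t}"
      using meas[of t] by (simp add: nn_integral_cmult_indicator)
    also have "\<dots> = ennreal (t ^ DIM('a) * exp (-t)) * indicator {0..} t * emeasure lborel {y. g y \<le> 1}"
    proof (cases "0 \<le> t")
      case True
      then show ?thesis by (simp add: vol[OF True] ennreal_mult mult_ac)
    next
      case False
      have "\<not> g y \<le> t" for y using nonneg[of y] False by linarith
      then have "{y. g y \<le> t} = {}" by blast
      then show ?thesis using False by simp
    qed
    finally show "(\<integral>\<^sup>+y. ennreal (exp (-t)) * (if g y \<le> t then 1 else 0) \<partial>lborel) = \<dots>" .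
  qed
  also have "\<dots> = (\<integral>\<^sup>+t. ennreal (t ^ DIM('a) * exp (-t)) * indicator {0..} t \<partial>lborel)
                   * emeasure lborel {y. g y \<le> 1}"
    by (intro nn_integral_multc) measurable
  finally show ?thesis
    by (simp add: nn_intergal_power_times_exp_Ici)
qed

section \<open>The potential whose minimiser is the Santalo point\<close>

lemma convex_bodyD:
  assumes "convex_body K"
  shows "compact K" "bounded K" "closed K" "convex K" "K \<noteq> {}" "interior K \<noteq> {}"
  using assms interior_subset[of K]
  by (auto simp: convex_body_def compact_imp_bounded compact_imp_closed)

definition polar_density :: "'a::euclidean_space set \<Rightarrow> 'a \<Rightarrow> 'a \<Rightarrow> real" where
  "polar_density K z y = exp (z \<bullet> y - support_fun K y)"

text \<open>Up to the factor $n!$ this is the volume of the polar body with centre \<open>z\<close>, at least for \<open>z\<close>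
  interior to \<open>K\<close>. The advantage over the volume itself is that the integrand depends on \<open>z\<close>
  through an exponential of a linear form and on \<open>K\<close> through its support function only.\<close>
definition polar_potential :: "'a::euclidean_space set \<Rightarrow> 'a \<Rightarrow> real" where
  "polar_potential K z = (\<integral>y. polar_density K z y \<partial>lborel)"

lemma borel_measurable_support_fun:
  "convex_body K \<Longrightarrow> support_fun K \<in> borel_measurable borel"
  by (intro borel_measurable_continuous_onI continuous_on_support_fun convex_bodyD)

lemma borel_measurable_polar_density:
  assumes "convex_body K"
  shows "polar_density K z \<in> borel_measurable borel"
proof -
  note [measurable] = borel_measurable_support_fun[OF assms]
  show ?thesis unfolding polar_density_def[abs_def] by measurable
qed

lemma support_fun_minus_inner_scaleR:
  assumes "convex_body K" "0 \<le> t"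
  shows "support_fun K (t *\<^sub>R y) - z \<bullet> (t *\<^sub>R y) = t * (support_fun K y - z \<bullet> y)"
  using assms by (simp add: support_fun_scaleR convex_bodyD right_diff_distrib)

text \<open>Interior points are seen by the support function as a linear gap, which makes the density
  decay exponentially.\<close>
lemma interior_support_fun_gap:
  assumes "convex_body K" "z \<in> interior K"
  obtains r where "r > 0" "\<And>y. z \<bullet> y + r * norm y \<le> support_fun K y"
proof -
  obtain r where "r > 0" "cball z r \<subseteq> K" using assms(2) mem_interior_cball by blast
  then show ?thesis using support_fun_ge_cball[of K z r] convex_bodyD[OF assms(1)] that by auto
qed

lemma nn_integral_polar_density:
  fixes K :: "'a::euclidean_space set"
  assumes K: "convex_body K" and z: "z \<in> interior K"
  shows "(\<integral>\<^sup>+y. ennreal (polar_density K z y) \<partial>lborel)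
           = ennreal (fact DIM('a)) * emeasure lborel (polar_body K z)"
    and "emeasure lborel (polar_body K z) < \<infinity>"
proof -
  obtain r where r: "r > 0" "\<And>y. z \<bullet> y + r * norm y \<le> support_fun K y"
    using interior_support_fun_gap[OF K z] by blast
  let ?g = "\<lambda>y. support_fun K y - z \<bullet> y"
  note [measurable] = borel_measurable_support_fun[OF K]
  have pos: "0 < ?g y" if "y \<noteq> 0" for y
    using r(2)[of y] mult_pos_pos[OF r(1), of "norm y"] that by simp
  have "(\<integral>\<^sup>+y. ennreal (exp (- ?g y)) \<partial>lborel) = ennreal (fact DIM('a)) * emeasure lborel {y. ?g y \<le> 1}"
    using pos support_fun_minus_inner_scaleR[OF K] by (intro nn_integral_exp_neg_gauge) auto
  then show "(\<integral>\<^sup>+y. ennreal (polar_density K z y) \<partial>lborel)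
           = ennreal (fact DIM('a)) * emeasure lborel (polar_body K z)"
    by (simp add: polar_density_def polar_body_eq convex_bodyD[OF K])
  have "norm y \<le> 1 / r" if "?g y \<le> 1" for y
    using r(1) r(2)[of y] that by (simp add: pos_le_divide_eq mult.commute)
  then have "polar_body K z \<subseteq> cball 0 (1 / r)"
    by (auto simp: polar_body_eq convex_bodyD[OF K])
  then show "emeasure lborel (polar_body K z) < \<infinity>"
    by (intro emeasure_bounded_finite) (rule bounded_subset[OF bounded_cball])
qed

lemma integrable_polar_density:
  fixes K :: "'a::euclidean_space set"
  assumes K: "convex_body K" and z: "z \<in> interior K"
  shows "integrable lborel (polar_density K z)"
proof (rule integrableI_nonneg)
  show "polar_density K z \<in> borel_measurable lborel"
    using borel_measurable_polar_density[OF K] by simp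
  have "ennreal (fact DIM('a)) * emeasure lborel (polar_body K z) < \<infinity>"
    using nn_integral_polar_density(2)[OF assms]
    by (simp add: ennreal_mult_less_top)
  then show "(\<integral>\<^sup>+y. ennreal (polar_density K z y) \<partial>lborel) < \<infinity>"
    by (simp add: nn_integral_polar_density(1)[OF assms])
qed (simp add: polar_density_def)

lemma polar_potential_eq_volume:
  fixes K :: "'a::euclidean_space set"
  assumes K: "convex_body K" and z: "z \<in> interior K"
  shows "polar_potential K z = fact DIM('a) * measure lebesgue (polar_body K z)"
proof -
  note [measurable] = borel_measurable_support_fun[OF K]
  have [measurable]: "polar_body K z \<in> sets borel"
    unfolding polar_body_eq[OF convex_bodyD(2)[OF K] convex_bodyD(5)[OF K]] by measurable
  have "polar_potential K z = enn2real (\<integral>\<^sup>+y. ennreal (polar_density K z y) \<partial>lborel)"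
    unfolding polar_potential_def using borel_measurable_polar_density[OF K]
    by (intro integral_eq_nn_integral) (auto simp: polar_density_def)
  also have "\<dots> = fact DIM('a) * measure lborel (polar_body K z)"
    by (simp add: nn_integral_polar_density(1)[OF assms] enn2real_mult measure_def)
  finally show ?thesis by simp
qed

section \<open>Existence of a minimiser\<close>

lemma suminf_const_ennreal:
  assumes "c \<noteq> (0::ennreal)"
  shows "(\<Sum>i::nat. c) = \<infinity>"
  using assms nn_integral_count_space_nat[of "\<lambda>_. c"] by (simp add: ennreal_mult_top)

text \<open>A boundary point \<open>z\<close> has a supporting hyperplane; moving in the direction \<open>b\<close> of its outer
  normal does not increase $h_K - \langle z,\cdot\rangle$. Hence the density is bounded below by a
  fixed constant on infinitely many disjoint translates of the unit ball.\<close>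
lemma nn_integral_polar_density_frontier:
  fixes K :: "'a::euclidean_space set"
  assumes K: "convex_body K" and z: "z \<in> K" "z \<notin> interior K"
  shows "(\<integral>\<^sup>+y. ennreal (polar_density K z y) \<partial>lborel) = \<infinity>"
proof -
  note Kb = convex_bodyD[OF K]
  obtain a where a: "a \<noteq> 0" "\<And>x. x \<in> K \<Longrightarrow> a \<bullet> z \<le> a \<bullet> x"
    using supporting_hyperplane_relative_frontier[OF Kb(4), of z] z Kb
      rel_interior_nonempty_interior[OF Kb(6)] by (metis closure_closed)
  define b where "b = - sgn a"
  have b: "norm b = 1" using a(1) by (simp add: b_def norm_sgn)
  have "x \<bullet> b \<le> z \<bullet> b" if "x \<in> K" for x
    using a(2)[OF that] by (simp add: b_def sgn_div_norm divide_right_mono inner_commute mult_left_mono)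
  then have hb: "support_fun K b \<le> z \<bullet> b" using support_fun_le_iff Kb by blast
  obtain R where R: "R > 0" "K \<subseteq> cball 0 R"
    using Kb(2) bounded_pos[of K] by (metis mem_cball_0 subsetI)
  \<comment> \<open>Unit balls whose centres are 3 apart are disjoint.\<close>
  define B where "B = (\<lambda>k::nat. ball ((3 * real k) *\<^sub>R b) 1)"
  have lower: "exp (- 2 * R) \<le> polar_density K z y" if "y \<in> B k" for y k
  proof -
    define w where "w = y - (3 * real k) *\<^sub>R b"
    have w: "norm w \<le> 1" "y = (3 * real k) *\<^sub>R b + w"
      using that by (auto simp: w_def B_def dist_norm norm_minus_commute)
    have "support_fun K y \<le> 3 * real k * (z \<bullet> b) + R * norm w"
      using support_fun_add_le[OF Kb(2,5), of "(3 * real k) *\<^sub>R b" w] 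
        support_fun_scaleR[OF Kb(2,5), of "3 * real k" b] mult_left_mono[OF hb, of "3 * real k"]
        support_fun_le_norm[OF Kb(5) R(2), of w] w(2) by simp
    moreover have "\<bar>z \<bullet> w\<bar> \<le> R * norm w"
      using Cauchy_Schwarz_ineq2[of z w] mult_right_mono[of "norm z" R "norm w"] R z(1) by force
    moreover have "R * norm w \<le> R" using w(1) R(1) by simp
    ultimately have "- 2 * R \<le> z \<bullet> y - support_fun K y"
      using w(2) by (simp add: inner_add_right)
    then show ?thesis by (simp add: polar_density_def)
  qed
  have "B j \<inter> B k = {}" if "j \<noteq> k" for j k
  proof -
    have "y \<notin> B k" if "y \<in> B j" for y
    proof
      assume "y \<in> B k"
      then have "dist ((3 * real j) *\<^sub>R b) ((3 * real k) *\<^sub>R b) < 2"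
        using that dist_triangle_less_add[of _ y 1 _ 1] unfolding B_def mem_ball by force
      moreover have "dist ((3 * real j) *\<^sub>R b) ((3 * real k) *\<^sub>R b) = \<bar>3 * real j - 3 * real k\<bar>"
        using b by (simp add: dist_norm flip: scaleR_left_diff_distrib)
      moreover have "\<bar>real j - real k\<bar> \<ge> 1" using \<open>j \<noteq> k\<close> by linarith
      ultimately show False by linarith
    qed
    then show ?thesis by blast
  qed
  then have disj: "disjoint_family B" by (auto simp: disjoint_family_on_def)
  have Bmeas[measurable]: "B k \<in> sets borel" for k by (simp add: B_def)
  have vol: "emeasure lborel (B k) = emeasure lborel (ball (0::'a) 1)" for k
    unfolding B_def by (simp add: emeasure_ball)
  have "emeasure lborel (ball (0::'a) 1) \<noteq> 0"
    by (simp add: emeasure_ball less_imp_neq[OF unit_ball_vol_pos, symmetric])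
  then have "emeasure lborel (\<Union>k. B k) = \<infinity>"
    using suminf_emeasure[OF _ disj, of lborel] Bmeas suminf_const_ennreal[of "emeasure lborel (ball (0::'a) 1)"]
    by (simp add: vol image_subset_iff)
  then have "ennreal (exp (- 2 * R)) * emeasure lborel (\<Union>k. B k) = \<infinity>"
    by (simp add: ennreal_mult_top)
  also have "ennreal (exp (- 2 * R)) * emeasure lborel (\<Union>k. B k)
      = (\<integral>\<^sup>+y. ennreal (exp (- 2 * R)) * indicator (\<Union>k. B k) y \<partial>lborel)"
    by (simp add: nn_integral_cmult_indicator)
  finally have "\<infinity> = (\<integral>\<^sup>+y. ennreal (exp (- 2 * R)) * indicator (\<Union>k. B k) y \<partial>lborel)" by simp
  also have "\<dots> \<le> (\<integral>\<^sup>+y. ennreal (polar_density K z y) \<partial>lborel)"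
    using lower by (intro nn_integral_mono) (auto simp: indicator_def intro!: ennreal_leI)
  finally show ?thesis by (simp add: top_unique)
qed

text \<open>The integral of the density, taken in \<open>[0,\<infinity>]\<close>, is lower semicontinuous in \<open>z\<close> by Fatou's
  lemma, so it attains its minimum over the compact set \<open>K\<close>. Being infinite on the boundary
  and finite inside, it does so at an interior point.\<close>
lemma ex_minimiser_polar_potential:
  fixes K :: "'a::euclidean_space set"
  assumes K: "convex_body K"
  shows "\<exists>z\<in>interior K. \<forall>w\<in>interior K. polar_potential K z \<le> polar_potential K w"
proof -
  note Kb = convex_bodyD[OF K]
  define F where "F z = (\<integral>\<^sup>+y. ennreal (polar_density K z y) \<partial>lborel)" for z
  obtain u where u: "\<And>n. u n \<in> F ` K" "u \<longlonglongrightarrow> Inf (F ` K)"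
    using Inf_as_limit[of "F ` K"] Kb(5) by blast
  have "\<forall>n. \<exists>x. x \<in> K \<and> u n = F x" using u(1) by blast
  then obtain x where x: "\<And>n. x n \<in> K" "\<And>n. u n = F (x n)" by metis
  obtain z \<phi> where z: "z \<in> K" "strict_mono \<phi>" "(x \<circ> \<phi>) \<longlonglongrightarrow> z"
    using Kb(1) x(1) unfolding compact_def by blast
  have Fz: "F z \<le> F w" if "w \<in> K" for w
  proof -
    have lim: "(\<lambda>n. ennreal (polar_density K (x (\<phi> n)) y)) \<longlonglongrightarrow> ennreal (polar_density K z y)" for y
      using z(3) unfolding polar_density_def comp_def by (intro tendsto_intros)
    have "F z = (\<integral>\<^sup>+y. liminf (\<lambda>n. ennreal (polar_density K (x (\<phi> n)) y)) \<partial>lborel)"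
      unfolding F_def using lim_imp_Liminf[OF _ lim] by simp
    also have "\<dots> \<le> liminf (\<lambda>n. F (x (\<phi> n)))"
      unfolding F_def using borel_measurable_polar_density[OF K]
      by (intro nn_integral_liminf) simp
    also have "(\<lambda>n. F (x (\<phi> n))) \<longlonglongrightarrow> Inf (F ` K)"
      using LIMSEQ_subseq_LIMSEQ[OF u(2) z(2)] by (simp add: comp_def x(2))
    then have "liminf (\<lambda>n. F (x (\<phi> n))) = Inf (F ` K)" by (intro lim_imp_Liminf) simp_all
    also have "\<dots> \<le> F w" using that by (intro INF_lower)
    finally show ?thesis .
  qed
  have fin: "F w < \<infinity>" if "w \<in> interior K" for w
    using integrable_polar_density[OF K that] unfolding F_def
    by (auto simp: integrable_iff_bounded polar_density_def)
  have pot: "polar_potential K w = enn2real (F w)" for w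
    unfolding polar_potential_def F_def using borel_measurable_polar_density[OF K]
    by (intro integral_eq_nn_integral) (auto simp: polar_density_def)
  obtain w0 where "w0 \<in> interior K" using Kb(6) by blast
  then have "F z < \<infinity>" using Fz fin interior_subset order_le_less_trans by blast
  then have "z \<in> interior K"
    using nn_integral_polar_density_frontier[OF K z(1)] unfolding F_def by (metis infinity_ennreal_def less_irrefl)
  moreover have "polar_potential K z \<le> polar_potential K w" if "w \<in> interior K" for w
    unfolding pot using Fz fin[OF that] that interior_subset[of K] by (intro enn2real_mono) auto
  ultimately show ?thesis by blast
qed

section \<open>Quadratic growth and uniqueness\<close>

text \<open>Two elementary forms of the mean value theorem for the exponential function: its slope is at
  least \<open>exp c\<close> to the right of \<open>c\<close>, and at most \<open>exp c\<close> to the left.\<close>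
lemma abs_exp_diff_ge:
  fixes a b c :: real
  assumes "c \<le> a" "c \<le> b"
  shows "exp c * \<bar>a - b\<bar> \<le> \<bar>exp a - exp b\<bar>"
proof -
  have *: "exp c * (a - b) \<le> exp a - exp b" if "b \<le> a" "c \<le> b" for a b
  proof -
    have "a - b \<le> exp (a - b) - 1" using exp_ge_add_one_self[of "a - b"] by linarith
    then have "exp c * (a - b) \<le> exp b * (exp (a - b) - 1)"
      using that by (intro mult_mono) auto
    then show ?thesis by (simp add: algebra_simps flip: exp_add)
  qed
  show ?thesis using *[of b a] *[of a b] assms by (cases "b \<le> a") (auto simp: abs_if)
qed

lemma abs_exp_diff_le:
  fixes a b c :: real
  assumes "a \<le> c" "b \<le> c"
  shows "\<bar>exp a - exp b\<bar> \<le> exp c * \<bar>a - b\<bar>"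
proof -
  have *: "exp a - exp b \<le> exp c * (a - b)" if "b \<le> a" "a \<le> c" for a b
  proof -
    have "1 - exp (b - a) \<le> a - b" using exp_ge_add_one_self[of "b - a"] by linarith
    then have "exp a * (1 - exp (b - a)) \<le> exp c * (a - b)"
      using that by (intro mult_mono) auto
    then show ?thesis by (simp add: algebra_simps flip: exp_add)
  qed
  show ?thesis using *[of b a] *[of a b] assms by (cases "b \<le> a") (auto simp: abs_if)
qed

text \<open>A linear form $\langle v,\cdot\rangle$ is at least a fixed multiple of $|v|$ on a ball of fixed
  size inside the unit ball. This replaces the exact second moments of the unit ball in the
  lower bound on the growth of the potential.\<close>
lemma inner_ge_on_ball:
  fixes v :: "'a::real_inner"
  assumes "y \<in> ball ((1/2) *\<^sub>R sgn v) (1/4)"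
  shows "norm v / 4 \<le> v \<bullet> y"
proof -
  define e where "e = y - (1/2) *\<^sub>R sgn v"
  have "norm e \<le> 1/4" using assms by (simp add: e_def dist_norm norm_minus_commute)
  then have "\<bar>v \<bullet> e\<bar> \<le> norm v * (1/4)"
    by (meson Cauchy_Schwarz_ineq2 mult_left_mono norm_ge_zero order_trans)
  moreover have "v \<bullet> sgn v = norm v"
    by (cases "v = 0") (simp_all add: sgn_div_norm dot_square_norm power2_eq_square)
  moreover have "v \<bullet> y = v \<bullet> sgn v / 2 + v \<bullet> e"
    by (simp add: e_def inner_diff_right)
  ultimately show ?thesis by linarith
qed

lemma measure_lborel_ball_translate:
  "0 \<le> r \<Longrightarrow> measure lborel (ball (c::'a::euclidean_space) r) = measure lborel (ball (0::'a) r)"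
  by (simp add: content_ball)

text \<open>Quadratic growth at a minimiser. With $m$ the midpoint of $z$ and $w$, the densities satisfy
  $p_w + p_z - 2 p_m = (\sqrt{p_w} - \sqrt{p_z})^2$. Integrating, and using that the potential at
  $m$ is not below its value at $z$, bounds the growth from below by the integral of this square,
  which is of order $|w - z|^2$ on a suitable ball. The constant depends on \<open>K\<close> only through a
  radius \<open>R\<close> of a ball that contains it.\<close>
lemma polar_potential_growth:
  fixes K :: "'a::euclidean_space set"
  assumes K: "convex_body K" and R: "K \<subseteq> cball 0 R"
    and z: "z \<in> interior K" "\<And>v. v \<in> interior K \<Longrightarrow> polar_potential K z \<le> polar_potential K v"
    and w: "w \<in> interior K"
  shows "exp (- 2 * R) / 64 * measure lborel (ball (0::'a) (1/4)) * (norm (w - z))\<^sup>2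
           \<le> polar_potential K w - polar_potential K z"
proof -
  note Kb = convex_bodyD[OF K]
  define m where "m = (1/2) *\<^sub>R z + (1/2) *\<^sub>R w"
  have m: "m \<in> interior K"
    unfolding m_def using convex_interior[OF Kb(4)] z(1) w by (intro convexD) auto
  \<comment> \<open>On this ball, which lies in the unit ball, the form (w - z) . y is bounded away from 0.\<close>
  define U where "U = ball ((1/2) *\<^sub>R sgn (w - z)) (1/4)"
  define k where "k = exp (- 2 * R) / 64 * (norm (w - z))\<^sup>2"
  note int = integrable_polar_density[OF K]
  have *: "indicat_real U y * k \<le> polar_density K w y + polar_density K z y - 2 * polar_density K m y" for y
  proof -
    \<comment> \<open>Half exponents, so that exp a and exp b are the square roots of the densities.\<close>
    define a b where "a = (w \<bullet> y - support_fun K y) / 2" and "b = (z \<bullet> y - support_fun K y) / 2"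
    have eq: "polar_density K w y + polar_density K z y - 2 * polar_density K m y = (exp a - exp b)\<^sup>2"
    proof -
      have "polar_density K w y = (exp a)\<^sup>2" "polar_density K z y = (exp b)\<^sup>2"
        by (simp_all add: polar_density_def a_def b_def flip: exp_double)
      moreover have "polar_density K m y = exp a * exp b"
        by (simp add: polar_density_def a_def b_def m_def inner_add_left flip: exp_add)
           (simp add: field_simps)
      ultimately show ?thesis by (simp add: power2_diff)
    qed
    show ?thesis
    proof (cases "y \<in> U")
      case True
      have R0: "0 \<le> R" using R z(1) interior_subset[of K] norm_ge_zero order_trans
        by (metis mem_cball_0 subsetD)
      have "norm y \<le> norm ((1/2) *\<^sub>R sgn (w - z)) + dist ((1/2) *\<^sub>R sgn (w - z)) y"
        by (metis dist_norm norm_minus_commute norm_triangle_sub add.commute)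
      then have ny: "norm y \<le> 1"
        using True by (auto simp: U_def norm_sgn split: if_splits)
      then have "R * norm y \<le> R" using R0 by (simp add: mult_left_le)
      then have hR: "support_fun K y \<le> R" using support_fun_le_norm[OF Kb(5) R, of y] by linarith
      have exponent_ge: "- R \<le> (x \<bullet> y - support_fun K y) / 2" if "x \<in> interior K" for x
      proof -
        have "norm x \<le> R" using that R interior_subset[of K] by auto
        then have "norm x * norm y \<le> R * norm y" by (intro mult_right_mono) auto
        then have "- R \<le> x \<bullet> y"
          using Cauchy_Schwarz_ineq2[of x y] \<open>R * norm y \<le> R\<close> by linarith
        then show ?thesis using hR by simp
      qed
      have ab: "- R \<le> a" "- R \<le> b"
        unfolding a_def b_def by (rule exponent_ge[OF w], rule exponent_ge[OF z(1)])
      have "a - b = (w - z) \<bullet> y / 2"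
        by (simp add: a_def b_def inner_diff_left flip: diff_divide_distrib)
      moreover have "norm (w - z) / 4 \<le> (w - z) \<bullet> y"
        using inner_ge_on_ball[of y "w - z"] True by (simp add: U_def)
      ultimately have "norm (w - z) / 8 \<le> \<bar>a - b\<bar>" by linarith
      then have "exp (- R) * (norm (w - z) / 8) \<le> \<bar>exp a - exp b\<bar>"
        using abs_exp_diff_ge[OF ab] by (meson exp_ge_zero mult_left_mono order_trans)
      then have "(exp (- R) * (norm (w - z) / 8))\<^sup>2 \<le> \<bar>exp a - exp b\<bar>\<^sup>2"
        by (intro power_mono) auto
      then have "k \<le> (exp a - exp b)\<^sup>2"
        by (simp add: k_def power_mult_distrib power_divide flip: exp_double)
      then show ?thesis using True eq by simp
    qed (simp add: eq)
  qed
  have Ufin: "integrable lborel (\<lambda>y. indicat_real U y * k)"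
    using emeasure_lborel_ball_finite[of "(1/2) *\<^sub>R sgn (w - z)" "1/4"]
    by (intro integrable_mult_left integrable_real_indicator) (simp_all add: U_def)
  have "measure lborel U * k = (\<integral>y. indicat_real U y * k \<partial>lborel)" by simp
  also have "\<dots> \<le> (\<integral>y. polar_density K w y + polar_density K z y - 2 * polar_density K m y \<partial>lborel)"
    using Ufin int[OF w] int[OF z(1)] int[OF m] * by (intro integral_mono) auto
  also have "\<dots> = polar_potential K w + polar_potential K z - 2 * polar_potential K m"
    using int[OF w] int[OF z(1)] int[OF m] by (simp add: polar_potential_def)
  also have "\<dots> \<le> polar_potential K w - polar_potential K z" using z(2)[OF m] by simp
  finally have "measure lborel U * k \<le> polar_potential K w - polar_potential K z" .
  moreover have "measure lborel U = measure lborel (ball (0::'a) (1/4))"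
    unfolding U_def by (rule measure_lborel_ball_translate) simp
  ultimately show ?thesis by (simp add: k_def mult_ac)
qed

lemma quadratic_growth_constant_pos:
  "0 < exp (- 2 * R) / 64 * measure lborel (ball (0::'a::euclidean_space) (1/4))"
  using content_ball_pos[of "1/4" "0::'a"] by simp

text \<open>Quadratic growth makes the minimiser unique, so the definite description that defines the
  Santalo point is meaningful and denotes the minimiser of the potential.\<close>
lemma santalo_point_minimiser:
  fixes K :: "'a::euclidean_space set"
  assumes K: "convex_body K"
  shows "santalo_point K \<in> interior K"
    and "\<And>w. w \<in> interior K \<Longrightarrow> polar_potential K (santalo_point K) \<le> polar_potential K w"
proof -
  let ?P = "\<lambda>z. z \<in> interior K \<and> (\<forall>w\<in>interior K. polar_potential K z \<le> polar_potential K w)"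
  obtain R where R: "K \<subseteq> cball 0 R"
    using convex_bodyD(2)[OF K] bounded_pos[of K] by (metis mem_cball_0 subsetI)
  obtain z where z: "?P z" using ex_minimiser_polar_potential[OF K] by blast
  have uniq: "w = z" if "?P w" for w
  proof -
    have "polar_potential K w = polar_potential K z" using that z by (meson order_antisym)
    then have "exp (- 2 * R) / 64 * measure lborel (ball (0::'a) (1/4)) * (norm (w - z))\<^sup>2 \<le> 0"
      using polar_potential_growth[OF K R, of z w] z that by simp
    then have "(norm (w - z))\<^sup>2 \<le> 0"
      using quadratic_growth_constant_pos[of R, where 'a='a] by (meson linorder_not_less mult_pos_pos)
    then show ?thesis by simp
  qed
  have iff: "?P v \<longleftrightarrow> v \<in> interior K \<and>
      (\<forall>w\<in>interior K. measure lebesgue (polar_body K v) \<le> measure lebesgue (polar_body K w))" for v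
    by (auto simp: polar_potential_eq_volume[OF K])
  have eq: "santalo_point K = (THE z. ?P z)" unfolding santalo_point_def iff ..
  have "?P (santalo_point K)" unfolding eq using z uniq by (rule theI[of ?P z])
  then show "santalo_point K \<in> interior K"
    and "\<And>w. w \<in> interior K \<Longrightarrow> polar_potential K (santalo_point K) \<le> polar_potential K w"
    by auto
qed

section \<open>Stability of the minimiser\<close>

text \<open>The potential is convex because \<open>exp\<close> is; so from \<open>z\<close> towards a point of smaller potential it
  never exceeds its value at \<open>z\<close>.\<close>
lemma polar_potential_segment_le:
  fixes K :: "'a::euclidean_space set"
  assumes K: "convex_body K" and z: "z \<in> interior K" and w: "w \<in> interior K"
    and t: "0 \<le> t" "t \<le> 1" and le: "polar_potential K w \<le> polar_potential K z"
  shows "z + t *\<^sub>R (w - z) \<in> interior K"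
    and "polar_potential K (z + t *\<^sub>R (w - z)) \<le> polar_potential K z"
proof -
  let ?v = "(1 - t) *\<^sub>R z + t *\<^sub>R w"
  have v: "z + t *\<^sub>R (w - z) = ?v" by (simp add: algebra_simps)
  have vi: "?v \<in> interior K"
    using convex_interior[OF convex_bodyD(4)[OF K]] z w t by (intro convexD) auto
  note int = integrable_polar_density[OF K]
  have *: "polar_density K ?v y \<le> (1 - t) * polar_density K z y + t * polar_density K w y" for y
  proof -
    have "?v \<bullet> y - support_fun K y = (1 - t) *\<^sub>R (z \<bullet> y - support_fun K y) + t *\<^sub>R (w \<bullet> y - support_fun K y)"
      by (simp add: inner_add_left algebra_simps)
    then show ?thesis
      using convex_onD[OF exp_convex t, of "z \<bullet> y - support_fun K y" "w \<bullet> y - support_fun K y"]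
      by (simp add: polar_density_def)
  qed
  have "polar_potential K ?v \<le> (\<integral>y. (1 - t) * polar_density K z y + t * polar_density K w y \<partial>lborel)"
    unfolding polar_potential_def using int[OF vi] int[OF z] int[OF w] *
    by (intro integral_mono) auto
  also have "\<dots> = (1 - t) * polar_potential K z + t * polar_potential K w"
    using int[OF z] int[OF w] by (simp add: polar_potential_def)
  also have "\<dots> \<le> polar_potential K z"
    using mult_left_mono[OF le t(1)] by (simp add: algebra_simps)
  finally show "polar_potential K (z + t *\<^sub>R (w - z)) \<le> polar_potential K z" by (simp add: v)
  show "z + t *\<^sub>R (w - z) \<in> interior K" using vi by (simp add: v)
qed

text \<open>A closed convex set is the intersection of its supporting half-spaces, so an inequality
  between support functions gives back an inclusion.\<close>
lemma cball_subset_if_support_fun_ge: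
  fixes K :: "'a::euclidean_space set"
  assumes K: "convex_body K" and ge: "\<And>y. z \<bullet> y + r * norm y \<le> support_fun K y"
  shows "cball z r \<subseteq> K"
proof (rule ccontr)
  note Kb = convex_bodyD[OF K]
  assume "\<not> cball z r \<subseteq> K"
  then obtain x where "x \<in> cball z r" and xK: "x \<notin> K" by blast
  then have x: "dist z x \<le> r" by simp
  obtain a b where ab: "a \<bullet> x < b" "\<And>y. y \<in> K \<Longrightarrow> b < a \<bullet> y"
    using separating_hyperplane_closed_point[OF Kb(4,3) xK] by blast
  have "support_fun K (- a) \<le> - b"
    using ab(2) support_fun_le_iff[OF Kb(2,5)] by (force simp: inner_commute)
  then have "z \<bullet> (- a) + r * norm a < x \<bullet> (- a)"
    using ge[of "- a"] ab(1) by (simp add: inner_commute)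
  moreover have "(x - z) \<bullet> (- a) \<le> r * norm a"
    using norm_cauchy_schwarz[of "x - z" "- a"] mult_right_mono[OF x, of "norm a"]
    by (simp add: dist_norm norm_minus_commute)
  ultimately show False by (simp add: inner_diff_left)
qed

text \<open>The layer-cake formula again, now for the gauge \<open>a * norm\<close>.\<close>
lemma integrable_exp_neg_norm:
  assumes "0 < a"
  shows "integrable lborel (\<lambda>y::'a::euclidean_space. exp (- (a * norm y)))"
proof (rule integrableI_nonneg)
  have "{y::'a. a * norm y \<le> 1} \<subseteq> cball 0 (1 / a)"
    using assms by (auto simp: pos_le_divide_eq mult.commute)
  then have "emeasure lborel {y::'a. a * norm y \<le> 1} < \<infinity>"
    by (intro emeasure_bounded_finite) (rule bounded_subset[OF bounded_cball])
  then have "ennreal (fact DIM('a)) * emeasure lborel {y::'a. a * norm y \<le> 1} < \<infinity>"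
    by (simp add: ennreal_mult_less_top)
  then show "(\<integral>\<^sup>+(y::'a). ennreal (exp (- (a * norm y))) \<partial>lborel) < \<infinity>"
    using assms by (subst nn_integral_exp_neg_gauge) auto
qed auto

lemma integrable_norm_sq_exp_neg_norm:
  assumes "0 < r"
  shows "integrable lborel (\<lambda>y::'a::euclidean_space. (norm y)\<^sup>2 * exp (- (2 * r * norm y)))"
proof (rule Bochner_Integration.integrable_bound)
  show "integrable lborel (\<lambda>y::'a. (2 / r\<^sup>2) * exp (- (r * norm y)))"
    using integrable_exp_neg_norm[OF assms] by (rule integrable_mult_right)
  show "AE y in lborel. norm ((norm y)\<^sup>2 * exp (- (2 * r * norm y)))
      \<le> norm ((2 / r\<^sup>2) * exp (- (r * norm (y::'a))))"
  proof (intro AE_I2)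
    fix y :: 'a
    have "(r * norm y)\<^sup>2 / 2 \<le> exp (r * norm y)"
      using exp_lower_Taylor_quadratic[of "r * norm y"] assms by (smt (verit) mult_nonneg_nonneg norm_ge_zero)
    then have "(norm y)\<^sup>2 \<le> 2 / r\<^sup>2 * exp (r * norm y)"
      using assms by (simp add: field_simps)
    then have "(norm y)\<^sup>2 * exp (- (2 * r * norm y)) \<le> 2 / r\<^sup>2 * exp (r * norm y) * exp (- (2 * r * norm y))"
      by (intro mult_right_mono) auto
    also have "\<dots> = 2 / r\<^sup>2 * exp (- (r * norm y))" by (simp add: algebra_simps flip: exp_add)
    finally show "norm ((norm y)\<^sup>2 * exp (- (2 * r * norm y)))
      \<le> norm ((2 / r\<^sup>2) * exp (- (r * norm (y::'a))))" by simp
  qed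
qed measurable

text \<open>The mixed difference is the integral of
  $(e^{\langle w,y\rangle} - e^{\langle s,y\rangle})\,(e^{-h_L(y)} - e^{-h_K(y)})$, where the first
  factor contributes $|w-s|\,|y|$ and the second $d_H(K,L)\,|y|$. A common ball around \<open>s\<close> supplies
  the decay that makes $|y|^2$ integrable: of its radius \<open>3 * r\<close>, a share \<open>r\<close> is lost in moving
  from \<open>s\<close> to \<open>w\<close>.\<close>
lemma polar_potential_diff_lipschitz:
  fixes K L :: "'a::euclidean_space set"
  assumes K: "convex_body K" and L: "convex_body L" and r: "0 < r"
    and ball: "cball s (3 * r) \<subseteq> K" "cball s (3 * r) \<subseteq> L"
    and ws: "norm (w - s) \<le> r"
  shows "\<bar>(polar_potential L w - polar_potential K w) - (polar_potential L s - polar_potential K s)\<bar>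
     \<le> hausdorff_dist K L * norm (w - s) * (\<integral>(y::'a). (norm y)\<^sup>2 * exp (- (2 * r * norm y)) \<partial>lborel)"
proof -
  note Kb = convex_bodyD[OF K] and Lb = convex_bodyD[OF L]
  define d where "d = hausdorff_dist K L"
  have "ball s (3 * r) \<subseteq> interior K" "ball s (3 * r) \<subseteq> interior L"
    using ball by (meson interior_maximal open_ball order_trans ball_subset_cball)+
  moreover have "w \<in> ball s (3 * r)" "s \<in> ball s (3 * r)"
    using ws r by (auto simp: dist_norm norm_minus_commute)
  ultimately have mem: "w \<in> interior K" "w \<in> interior L" "s \<in> interior K" "s \<in> interior L" by auto
  note intK = integrable_polar_density[OF K] and intL = integrable_polar_density[OF L]
  let ?f = "\<lambda>y. (polar_density L w y - polar_density K w y) - (polar_density L s y - polar_density K s y)"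
  let ?g = "\<lambda>y::'a. d * norm (w - s) * ((norm y)\<^sup>2 * exp (- (2 * r * norm y)))"
  have bound: "\<bar>?f y\<bar> \<le> ?g y" for y
  proof -
    have hd: "\<bar>- support_fun L y - (- support_fun K y)\<bar> \<le> d * norm y"
      using support_fun_le_hausdorff_dist[OF Kb(1,5) Lb(1,5), of y]
        support_fun_le_hausdorff_dist[OF Lb(1,5) Kb(1,5), of y]
      by (simp add: d_def hausdorff_dist_commute abs_le_iff)
    have lo: "- support_fun L y \<le> - (s \<bullet> y + 3 * r * norm y)" "- support_fun K y \<le> - (s \<bullet> y + 3 * r * norm y)"
      using support_fun_ge_cball[OF Kb(2) ball(1), of y] support_fun_ge_cball[OF Lb(2) ball(2), of y] r
      by auto
    have win: "\<bar>w \<bullet> y - s \<bullet> y\<bar> \<le> norm (w - s) * norm y"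
      using Cauchy_Schwarz_ineq2[of "w - s" y] by (simp add: inner_diff_left)
    have "norm (w - s) * norm y \<le> r * norm y" using ws by (intro mult_right_mono) auto
    then have up: "w \<bullet> y \<le> s \<bullet> y + r * norm y" "s \<bullet> y \<le> s \<bullet> y + r * norm y"
      using win r by auto
    have "?f y = (exp (w \<bullet> y) - exp (s \<bullet> y)) * (exp (- support_fun L y) - exp (- support_fun K y))"
      by (simp add: polar_density_def exp_diff exp_minus field_simps)
    then have "\<bar>?f y\<bar> = \<bar>exp (w \<bullet> y) - exp (s \<bullet> y)\<bar> * \<bar>exp (- support_fun L y) - exp (- support_fun K y)\<bar>"
      by (simp add: abs_mult)
    also have "\<dots> \<le> (exp (s \<bullet> y + r * norm y) * (norm (w - s) * norm y))
                   * (exp (- (s \<bullet> y + 3 * r * norm y)) * (d * norm y))"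
      using abs_exp_diff_le[OF up] abs_exp_diff_le[OF lo]
        mult_left_mono[OF win, of "exp (s \<bullet> y + r * norm y)"]
        mult_left_mono[OF hd, of "exp (- (s \<bullet> y + 3 * r * norm y))"]
      by (intro mult_mono) (auto intro: order_trans)
    also have "\<dots> = d * norm (w - s) * (norm y)\<^sup>2 * (exp (s \<bullet> y + r * norm y) * exp (- (s \<bullet> y + 3 * r * norm y)))"
      by (simp add: power2_eq_square)
    also have "exp (s \<bullet> y + r * norm y) * exp (- (s \<bullet> y + 3 * r * norm y)) = exp (- (2 * r * norm y))"
      by (simp flip: exp_add)
    finally show ?thesis by (simp add: mult.assoc)
  qed
  have intg: "integrable lborel ?g"
    using integrable_norm_sq_exp_neg_norm[OF r] by (rule integrable_mult_right)
  have intf: "integrable lborel ?f" using intK intL mem by simp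
  have "(polar_potential L w - polar_potential K w) - (polar_potential L s - polar_potential K s)
      = (\<integral>y. ?f y \<partial>lborel)"
    using intK intL mem by (simp add: polar_potential_def)
  also have "\<bar>\<dots>\<bar> \<le> (\<integral>y. \<bar>?f y\<bar> \<partial>lborel)" by (rule integral_abs_bound)
  also have "\<dots> \<le> (\<integral>y. ?g y \<partial>lborel)"
    using intf intg bound by (intro integral_mono integrable_abs) auto
  also have "\<dots> = d * norm (w - s) * (\<integral>(y::'a). (norm y)\<^sup>2 * exp (- (2 * r * norm y)) \<partial>lborel)"
    by (rule integral_mult_right_zero)
  finally show ?thesis unfolding d_def .
qed

text \<open>Quadratic growth of the potential of \<open>L\<close> at its minimiser $s$ is compared with the mixed
  difference: if $w$ is near $s$ and has no larger \<open>K\<close>-potential than $s$, then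
  $\kappa |w-s|^2 \le M\, d_H(K,L)\, |w-s|$. The Santalo point of \<open>K\<close> itself is not known in
  advance to be near $s$, so \<open>w\<close> is taken on the segment from $s$ to it, at distance at most \<open>r\<close>.
  For small $d_H(K,L)$ the estimate shows that $w$ is strictly closer than \<open>r\<close>, and therefore is
  the Santalo point of \<open>K\<close>.\<close>
lemma santalo_point_locally_lipschitz:
  fixes L :: "'a::euclidean_space set"
  assumes L: "convex_body L"
  shows "\<exists>C>0. \<exists>\<delta>>0. \<forall>K. convex_body K \<longrightarrow> hausdorff_dist K L \<le> \<delta> \<longrightarrow>
           norm (santalo_point K - santalo_point L) \<le> C * hausdorff_dist K L"
proof -
  note Lb = convex_bodyD[OF L] and sL = santalo_point_minimiser[OF L]
  define s where "s = santalo_point L"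
  obtain R where R: "L \<subseteq> cball 0 R"
    using Lb(2) bounded_pos[of L] by (metis mem_cball_0 subsetI)
  obtain r0 where "r0 > 0" "cball s r0 \<subseteq> L" using sL(1) mem_interior_cball s_def by metis
  then obtain r where r: "r > 0" "cball s (4 * r) \<subseteq> L"
    by (intro that[of "r0 / 4"]) auto
  define \<kappa> where "\<kappa> = exp (- 2 * R) / 64 * measure lborel (ball (0::'a) (1/4))"
  define M where "M = (\<integral>(y::'a). (norm y)\<^sup>2 * exp (- (2 * r * norm y)) \<partial>lborel)"
  have \<kappa>: "\<kappa> > 0" unfolding \<kappa>_def by (rule quadratic_growth_constant_pos)
  have M: "M \<ge> 0" unfolding M_def by (intro integral_nonneg_AE) auto
  \<comment> \<open>The summand 1 only serves to make C visibly positive.\<close>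
  define C where "C = (M + 1) / \<kappa>"
  have C: "C > 0" using \<kappa> M by (simp add: C_def)
  \<comment> \<open>The first bound puts the ball of radius 3 * r around s inside K, the second excludes w on the sphere of radius r.\<close>
  define \<delta> where "\<delta> = min r (r / (2 * C))"
  have \<delta>: "\<delta> > 0" "\<delta> \<le> r" "C * \<delta> < r"
    using r C by (auto simp: \<delta>_def min_def field_simps)
  have "norm (santalo_point K - s) \<le> C * hausdorff_dist K L"
    if K: "convex_body K" and d: "hausdorff_dist K L \<le> \<delta>" for K
  proof -
    note Kb = convex_bodyD[OF K] and sK = santalo_point_minimiser[OF K]
    have "s \<bullet> y + 3 * r * norm y \<le> support_fun K y" for y
    proof -
      have "hausdorff_dist L K * norm y \<le> r * norm y"
        using d \<delta>(2) by (intro mult_right_mono) (auto simp: hausdorff_dist_commute)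
      then show ?thesis
        using support_fun_ge_cball[OF Lb(2) r(2), of y] r(1)
          support_fun_le_hausdorff_dist[OF Lb(1,5) Kb(1,5), of y] by simp
    qed
    then have ballK: "cball s (3 * r) \<subseteq> K" by (rule cball_subset_if_support_fun_ge[OF K])
    have ballL: "cball s (3 * r) \<subseteq> L" using r by auto
    have sintK: "s \<in> interior K" using ballK r(1) mem_interior_cball[of s K] by auto
    define n where "n = norm (santalo_point K - s)"
    define t where "t = (if n \<le> r then 1 else r / n)"
    have t: "0 \<le> t" "t \<le> 1" using r by (auto simp: t_def)
    define w where "w = s + t *\<^sub>R (santalo_point K - s)"
    have ws: "norm (w - s) = min n r" using r t by (auto simp: w_def t_def min_def simp flip: n_def)
    have "norm (w - s) \<le> r" by (simp add: ws)
    have wL: "w \<in> interior L"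
    proof -
      have "w \<in> ball s (4 * r)" using ws r(1) by (auto simp: dist_norm norm_minus_commute)
      moreover have "ball s (4 * r) \<subseteq> interior L"
        using r(2) ball_subset_cball by (intro interior_maximal) auto
      ultimately show ?thesis by blast
    qed
    have wle: "polar_potential K w \<le> polar_potential K s"
      unfolding w_def using polar_potential_segment_le(2)[OF K sintK sK(1) t sK(2)[OF sintK]] .
    have "\<kappa> * (norm (w - s))\<^sup>2 \<le> polar_potential L w - polar_potential L s"
      unfolding \<kappa>_def s_def using polar_potential_growth[OF L R sL wL] .
    also have "\<dots> \<le> hausdorff_dist K L * norm (w - s) * M"
      using polar_potential_diff_lipschitz[OF K L r(1) ballK ballL \<open>norm (w - s) \<le> r\<close>] wle
      unfolding M_def by linarith
    finally have main: "\<kappa> * (norm (w - s))\<^sup>2 \<le> hausdorff_dist K L * norm (w - s) * M" .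
    have "norm (w - s) \<le> C * hausdorff_dist K L"
    proof (cases "norm (w - s) = 0")
      case True
      then show ?thesis using C hausdorff_dist_nonneg[of K L] by simp
    next
      case False
      then have "\<kappa> * norm (w - s) \<le> hausdorff_dist K L * M"
        using main by (simp add: power2_eq_square)
      also have "\<dots> \<le> hausdorff_dist K L * (M + 1)"
        using hausdorff_dist_nonneg[of K L] by (intro mult_left_mono) auto
      finally show ?thesis using \<kappa> by (simp add: C_def field_simps)
    qed
    moreover have "C * hausdorff_dist K L < r"
      using mult_left_mono[OF d less_imp_le[OF C]] \<delta>(3) by linarith
    ultimately show ?thesis using ws by (simp add: n_def min_def split: if_splits)
  qed
  then show ?thesis using C \<delta>(1) unfolding s_def by blast
qed

theorem proposition1:
  shows "continuous_map convex_bodies.mtopology euclidean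
           (santalo_point :: (real ^ 'n) set \<Rightarrow> real ^ 'n) \<and>
         (\<forall>K0 :: (real ^ 'n) set. convex_body K0 \<longrightarrow>
           (\<exists>C > 0. \<exists>\<delta> > 0. \<forall>K. convex_body K \<longrightarrow> hausdorff_dist K K0 \<le> \<delta> \<longrightarrow>
              norm (santalo_point K - santalo_point K0) \<le> C * hausdorff_dist K K0))"
proof (intro conjI allI impI)
  have "\<exists>\<delta>>0. \<forall>K. K \<in> convex_bodies \<and> hausdorff_dist L K < \<delta> \<longrightarrow>
          dist (santalo_point L) (santalo_point K) < \<epsilon>"
    if L: "L \<in> convex_bodies" and \<epsilon>: "\<epsilon> > 0" for L :: "(real ^ 'n) set" and \<epsilon>
  proof -
    have "convex_body L" using L by (simp add: convex_bodies_def)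
    from santalo_point_locally_lipschitz[OF this]
    obtain C \<delta> where C: "C > 0" "\<delta> > 0" and lip: "\<forall>K. convex_body K \<longrightarrow> hausdorff_dist K L \<le> \<delta> \<longrightarrow>
        norm (santalo_point K - santalo_point L) \<le> C * hausdorff_dist K L"
      by blast
    show ?thesis
    proof (intro exI[of _ "min \<delta> (\<epsilon> / C)"] conjI allI impI)
      show "0 < min \<delta> (\<epsilon> / C)" using C \<epsilon> by simp
      fix K :: "(real ^ 'n) set"
      assume K: "K \<in> convex_bodies \<and> hausdorff_dist L K < min \<delta> (\<epsilon> / C)"
      then have "norm (santalo_point K - santalo_point L) \<le> C * hausdorff_dist K L"
        using lip by (simp add: convex_bodies_def hausdorff_dist_commute[of L])
      also have "\<dots> < \<epsilon>"
        using K C(1) by (simp add: hausdorff_dist_commute[of L] pos_less_divide_eq mult.commute)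
      finally show "dist (santalo_point L) (santalo_point K) < \<epsilon>"
        by (simp add: dist_norm norm_minus_commute)
    qed
  qed
  then have "continuous_map convex_bodies.mtopology Met_TC.mtopology
      (santalo_point :: (real ^ 'n) set \<Rightarrow> real ^ 'n)"
    unfolding convex_bodies.metric_continuous_map[OF Met_TC.Metric_space_axioms] by blast
  then show "continuous_map convex_bodies.mtopology euclidean
      (santalo_point :: (real ^ 'n) set \<Rightarrow> real ^ 'n)" by simp
next
  fix K0 :: "(real ^ 'n) set"
  assume "convex_body K0"
  then show "\<exists>C > 0. \<exists>\<delta> > 0. \<forall>K. convex_body K \<longrightarrow> hausdorff_dist K K0 \<le> \<delta> \<longrightarrow>
      norm (santalo_point K - santalo_point K0) \<le> C * hausdorff_dist K K0"
    by (rule santalo_point_locally_lipschitz)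
qed

end
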